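(* Let $S$ be a Clifford semigroup and let $s(a,b)=(ab,\theta_a(b))$ be an $\mathrm{E}(S)$-invariant solution on $S$. Then, for every $e\in \mathrm{E}(S)$, the map $\theta_e$ satisfies $$\theta_e(ab)=\theta_e(a)\,\theta_e(a)^{-1}\,\theta_e(ab)\qquad\text{for all } a,b\in S,$$ and $$\theta_a(b)=\theta_e(a)^{-1}\,\theta_e(ab)$$ for all $a,b\in S$ and $e\in \mathrm{E}(S)$. Moreover, let $K$ be the kernel of $s$ and $\tau=\mathrm{E}(S)\times \mathrm{E}(S)$. Then $(K,\tau)$ is a congruence pair of $S$, $S/\rho_{(K,\tau)}$ is a group, and, for every $e\in\mathrm{E}(S)$, $\theta_e(S)$ is a system of representatives of $S/\rho_{(K,\tau)}$ and $(\theta_e(a),a)\in\rho_{(K,\tau)}$ for every $a\in S$.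
   Context: A semigroup $S$ is inverse if for each $a\in S$ there is a unique $a^{-1}\in S$ with $aa^{-1}a=a$ and $a^{-1}aa^{-1}=a^{-1}$; it is a Clifford semigroup if moreover its idempotents are central (equivalently $aa^{-1}=a^{-1}a$ for all $a$). $\mathrm{E}(S)$ is the set of idempotents. For $a,b\in S$, write $a\le b$ if $aa^{-1}\cdot bb^{-1}=aa^{-1}$ (a preorder on $S$). A solution (of the pentagon equation) on a semigroup $S$ is a map $s:S\times S\to S\times S$, $s(a,b)=(ab,\theta_a(b))$, where $ab$ is the product of $S$ and $\theta_a:S\to S$ are maps satisfying $\theta_a(b)\theta_{ab}(c)=\theta_a(bc)$ and $\theta_{\theta_a(b)}\theta_{ab}=\theta_b$ (composition of maps) for all $a,b,c\in S$. It is $\mathrm{E}(S)$-invariant (idempotent-invariant) if $\theta_a(e)=\theta_a(f)$ for all $a\in S$, $e,f\in\mathrm{E}(S)$. The kernel of $s$ is $K=\{a\in S\mid \theta_e(a)\in\mathrm{E}(S)\text{ for all } e\in\mathrm{E}(S)\text{ with } e\le a\}$. A normal subsemigroup of $S$ is a subsemigroup $K$ with $\mathrm{E}(S)\subseteq K$ and $a^{-1}Ka\subseteq K$ for all $a\in S$. A congruence $\tau$ on $\mathrm{E}(S)$ is normal if $e\,\tau\,f$ implies $a^{-1}ea\,\tau\,a^{-1}fa$ for all $a\in S$. A pair $(K,\tau)$, with $K$ a normal subsemigroup of $S$ and $\tau$ a normal congruence on $\mathrm{E}(S)$, is a congruence pair of $S$ if for all $a\in S$, $e\in\mathrm{E}(S)$: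 $ae\in K$ and $(e,a^{-1}a)\in\tau$ imply $a\in K$. For a congruence pair, $\rho_{(K,\tau)}=\{(a,b)\in S\times S\mid (a^{-1}a,b^{-1}b)\in\tau,\ ab^{-1}\in K\}$, which is a congruence on $S$. A system of representatives of $S/\rho$ is a subset of $S$ containing exactly one element of each $\rho$-class. *)

theory Defs
  imports "HOL-Algebra.Group"
begin

text \<open>
  Semigroups are carried by the record type \<open>monoid\<close>, of which only \<open>carrier\<close> and \<open>\<otimes>\<close>
  are used: nothing is assumed about the field \<open>one\<close>, so a semigroup need not have an identity.
  As usual in semigroup theory, semigroups are nonempty.
\<close>

locale semigroup_on =
  fixes S (structure)
  assumes carrier_nonempty: "carrier S \<noteq> {}"
    and mult_closed: "\<lbrakk>a \<in> carrier S; b \<in> carrier S\<rbrakk> \<Longrightarrow> a \<otimes> b \<in> carrier S"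
    and mult_assoc: "\<lbrakk>a \<in> carrier S; b \<in> carrier S; c \<in> carrier S\<rbrakk>
      \<Longrightarrow> (a \<otimes> b) \<otimes> c = a \<otimes> (b \<otimes> c)"

definition is_sinv :: "('a, 'm) monoid_scheme \<Rightarrow> 'a \<Rightarrow> 'a \<Rightarrow> bool"
  where "is_sinv S a x \<longleftrightarrow> x \<in> carrier S \<and>
    a \<otimes>\<^bsub>S\<^esub> x \<otimes>\<^bsub>S\<^esub> a = a \<and> x \<otimes>\<^bsub>S\<^esub> a \<otimes>\<^bsub>S\<^esub> x = x"

text \<open>
  This is the inverse in the sense of inverse semigroups; \<open>m_inv\<close> would be the inverse with
  respect to \<open>\<one>\<close>.
\<close>

definition sinv :: "('a, 'm) monoid_scheme \<Rightarrow> 'a \<Rightarrow> 'a"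
  where "sinv S a = (THE x. is_sinv S a x)"

definition idems :: "('a, 'm) monoid_scheme \<Rightarrow> 'a set"
  where "idems S = {e \<in> carrier S. e \<otimes>\<^bsub>S\<^esub> e = e}"

locale inverse_semigroup = semigroup_on +
  assumes ex1_sinv: "a \<in> carrier S \<Longrightarrow> \<exists>!x. is_sinv S a x"

locale clifford_semigroup = inverse_semigroup +
  assumes idems_central: "\<lbrakk>e \<in> idems S; a \<in> carrier S\<rbrakk> \<Longrightarrow> e \<otimes> a = a \<otimes> e"

definition sle :: "('a, 'm) monoid_scheme \<Rightarrow> 'a \<Rightarrow> 'a \<Rightarrow> bool"
  where "sle S a b \<longleftrightarrow>
    (a \<otimes>\<^bsub>S\<^esub> sinv S a) \<otimes>\<^bsub>S\<^esub> (b \<otimes>\<^bsub>S\<^esub> sinv S b) = a \<otimes>\<^bsub>S\<^esub> sinv S a"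

text \<open>
  The maps \<open>\<theta>\<^sub>a\<close> are \<open>\<theta> a\<close>. Equality of maps on the semigroup is equality on its carrier.
\<close>

definition pentagon_solution ::
    "('a, 'm) monoid_scheme \<Rightarrow> ('a \<times> 'a \<Rightarrow> 'a \<times> 'a) \<Rightarrow> ('a \<Rightarrow> 'a \<Rightarrow> 'a) \<Rightarrow> bool"
  where "pentagon_solution S s \<theta> \<longleftrightarrow>
    (\<forall>a\<in>carrier S. \<forall>b\<in>carrier S. s (a, b) = (a \<otimes>\<^bsub>S\<^esub> b, \<theta> a b)) \<and>
    (\<forall>a\<in>carrier S. \<forall>b\<in>carrier S. \<theta> a b \<in> carrier S) \<and>
    (\<forall>a\<in>carrier S. \<forall>b\<in>carrier S. \<forall>c\<in>carrier S.
       \<theta> a b \<otimes>\<^bsub>S\<^esub> \<theta> (a \<otimes>\<^bsub>S\<^esub> b) c = \<theta> a (b \<otimes>\<^bsub>S\<^esub> c)) \<and>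
    (\<forall>a\<in>carrier S. \<forall>b\<in>carrier S. \<forall>c\<in>carrier S.
       \<theta> (\<theta> a b) (\<theta> (a \<otimes>\<^bsub>S\<^esub> b) c) = \<theta> b c)"

definition idem_invariant :: "('a, 'm) monoid_scheme \<Rightarrow> ('a \<Rightarrow> 'a \<Rightarrow> 'a) \<Rightarrow> bool"
  where "idem_invariant S \<theta> \<longleftrightarrow>
    (\<forall>a\<in>carrier S. \<forall>e\<in>idems S. \<forall>f\<in>idems S. \<theta> a e = \<theta> a f)"

definition solution_kernel :: "('a, 'm) monoid_scheme \<Rightarrow> ('a \<Rightarrow> 'a \<Rightarrow> 'a) \<Rightarrow> 'a set"
  where "solution_kernel S \<theta> =
    {a \<in> carrier S. \<forall>e\<in>idems S. sle S e a \<longrightarrow> \<theta> e a \<in> idems S}"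

definition normal_subsemigroup :: "('a, 'm) monoid_scheme \<Rightarrow> 'a set \<Rightarrow> bool"
  where "normal_subsemigroup S K \<longleftrightarrow>
    K \<subseteq> carrier S \<and>
    (\<forall>a\<in>K. \<forall>b\<in>K. a \<otimes>\<^bsub>S\<^esub> b \<in> K) \<and>
    idems S \<subseteq> K \<and>
    (\<forall>a\<in>carrier S. \<forall>k\<in>K. sinv S a \<otimes>\<^bsub>S\<^esub> k \<otimes>\<^bsub>S\<^esub> a \<in> K)"

definition congruence_on :: "('a, 'm) monoid_scheme \<Rightarrow> 'a set \<Rightarrow> ('a \<times> 'a) set \<Rightarrow> bool"
  where "congruence_on S A \<rho> \<longleftrightarrow>
    equiv A \<rho> \<and>
    (\<forall>(a, b)\<in>\<rho>. \<forall>(c, d)\<in>\<rho>. (a \<otimes>\<^bsub>S\<^esub> c, b \<otimes>\<^bsub>S\<^esub> d) \<in> \<rho>)"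

definition normal_congruence :: "('a, 'm) monoid_scheme \<Rightarrow> ('a \<times> 'a) set \<Rightarrow> bool"
  where "normal_congruence S \<tau> \<longleftrightarrow>
    congruence_on S (idems S) \<tau> \<and>
    (\<forall>a\<in>carrier S. \<forall>(e, f)\<in>\<tau>.
       (sinv S a \<otimes>\<^bsub>S\<^esub> e \<otimes>\<^bsub>S\<^esub> a, sinv S a \<otimes>\<^bsub>S\<^esub> f \<otimes>\<^bsub>S\<^esub> a) \<in> \<tau>)"

definition congruence_pair :: "('a, 'm) monoid_scheme \<Rightarrow> 'a set \<Rightarrow> ('a \<times> 'a) set \<Rightarrow> bool"
  where "congruence_pair S K \<tau> \<longleftrightarrow>
    normal_subsemigroup S K \<and>
    normal_congruence S \<tau> \<and>
    (\<forall>a\<in>carrier S. \<forall>e\<in>idems S.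
       a \<otimes>\<^bsub>S\<^esub> e \<in> K \<longrightarrow> (e, sinv S a \<otimes>\<^bsub>S\<^esub> a) \<in> \<tau> \<longrightarrow> a \<in> K)"

definition pair_rel :: "('a, 'm) monoid_scheme \<Rightarrow> 'a set \<Rightarrow> ('a \<times> 'a) set \<Rightarrow> ('a \<times> 'a) set"
  where "pair_rel S K \<tau> =
    {(a, b). a \<in> carrier S \<and> b \<in> carrier S \<and>
      (sinv S a \<otimes>\<^bsub>S\<^esub> a, sinv S b \<otimes>\<^bsub>S\<^esub> b) \<in> \<tau> \<and> a \<otimes>\<^bsub>S\<^esub> sinv S b \<in> K}"

text \<open>
  When \<open>\<rho>\<close> is a congruence, the union defining the product of the classes of \<open>a\<close> and \<open>b\<close> is the
  single class of \<open>a \<otimes> b\<close>. The record needs a value for \<open>one\<close>, which a semigroup quotient does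
  not provide; it is therefore a parameter \<open>u\<close>, quantified existentially in
  \<open>quotient_is_group\<close>.
\<close>

definition quotient_struct ::
    "('a, 'm) monoid_scheme \<Rightarrow> ('a \<times> 'a) set \<Rightarrow> 'a set \<Rightarrow> 'a set monoid"
  where "quotient_struct S \<rho> u =
    \<lparr>carrier = carrier S // \<rho>,
     mult = (\<lambda>A B. \<Union>a\<in>A. \<Union>b\<in>B. \<rho> `` {a \<otimes>\<^bsub>S\<^esub> b}),
     one = u\<rparr>"

definition quotient_is_group :: "('a, 'm) monoid_scheme \<Rightarrow> ('a \<times> 'a) set \<Rightarrow> bool"
  where "quotient_is_group S \<rho> \<longleftrightarrow>
    congruence_on S (carrier S) \<rho> \<and> (\<exists>u. group (quotient_struct S \<rho> u))"

definition representatives :: "'a set \<Rightarrow> ('a \<times> 'a) set \<Rightarrow> 'a set \<Rightarrow> bool"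
  where "representatives A \<rho> T \<longleftrightarrow> T \<subseteq> A \<and> (\<forall>C\<in>A // \<rho>. \<exists>!x. x \<in> T \<inter> C)"

end

theory Submission
  imports Defs
begin

text \<open>
  Write \<open>a\<degree> = a a\<inverse>\<close>. Idempotent invariance first gives \<open>\<theta>\<^sub>a(b)\<degree> = \<theta>\<^sub>a(e)\<close> and
  \<open>\<theta>\<^sub>a(e) \<in> E(S)\<close>, and then the second pentagon identity forces \<open>\<theta>\<^sub>a(e)\<close> to be independent of \<open>a\<close>.
  So all the maps \<open>\<theta>\<^sub>a\<close> take values in one maximal subgroup of \<open>S\<close>, in which one can cancel.
  It follows that the maps \<open>\<theta>\<^sub>e\<close> with \<open>e\<close> idempotent all equal a single idempotent map \<open>\<phi>\<close>, with
  \<open>\<theta>\<^sub>a(b) = \<phi>(a)\<inverse> \<phi>(ab)\<close> and \<open>\<phi>(a\<inverse>c) = \<phi>(\<phi>(a)\<inverse> \<phi>(c))\<close>. The last identity makes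
  \<open>{(a, b). \<phi>(a) = \<phi>(b)}\<close> a group congruence, and this is the relation \<open>\<rho>\<^bsub>(K,\<tau>)\<^esub>\<close>.
\<close>

section \<open>Inverses and idempotents in inverse semigroups\<close>

context inverse_semigroup
begin

lemma idems_carrier: "e \<in> idems S \<Longrightarrow> e \<in> carrier S"
  and idems_idem: "e \<in> idems S \<Longrightarrow> e \<otimes> e = e"
  by (simp_all add: idems_def)

lemma idem_left_absorb: "\<lbrakk>e \<in> idems S; a \<in> carrier S\<rbrakk> \<Longrightarrow> e \<otimes> (e \<otimes> a) = e \<otimes> a"
  using mult_assoc[of e e a] by (simp add: idems_carrier idems_idem)

lemma is_sinv_sinv: "a \<in> carrier S \<Longrightarrow> is_sinv S a (sinv S a)"
  unfolding sinv_def using ex1_sinv by (rule theI')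

lemma sinv_eqI: "\<lbrakk>a \<in> carrier S; is_sinv S a x\<rbrakk> \<Longrightarrow> sinv S a = x"
  using ex1_sinv is_sinv_sinv by blast

lemma sinv_closed: "a \<in> carrier S \<Longrightarrow> sinv S a \<in> carrier S"
  and mult_sinv_mult: "a \<in> carrier S \<Longrightarrow> a \<otimes> (sinv S a \<otimes> a) = a"
  and sinv_mult_sinv: "a \<in> carrier S \<Longrightarrow> sinv S a \<otimes> (a \<otimes> sinv S a) = sinv S a"
  using is_sinv_sinv[of a] mult_assoc[of a "sinv S a" a] mult_assoc[of "sinv S a" a "sinv S a"]
  by (simp_all add: is_sinv_def)

lemma mult_sinv_idem: "a \<in> carrier S \<Longrightarrow> a \<otimes> sinv S a \<in> idems S"
  and sinv_mult_idem: "a \<in> carrier S \<Longrightarrow> sinv S a \<otimes> a \<in> idems S"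
  by (simp_all add: idems_def mult_closed sinv_closed mult_assoc sinv_mult_sinv mult_sinv_mult)

lemma sinv_idem: "e \<in> idems S \<Longrightarrow> sinv S e = e"
  by (rule sinv_eqI) (simp_all add: is_sinv_def idems_def)

end

section \<open>Central idempotents and idempotent parts\<close>

context clifford_semigroup
begin

lemma idem_left_commute:
  "\<lbrakk>e \<in> idems S; a \<in> carrier S; b \<in> carrier S\<rbrakk> \<Longrightarrow> a \<otimes> (e \<otimes> b) = e \<otimes> (a \<otimes> b)"
  using mult_assoc[of a e b] mult_assoc[of e a b] idems_central[of e a] by (simp add: idems_carrier)

lemma idems_mult: "\<lbrakk>e \<in> idems S; f \<in> idems S\<rbrakk> \<Longrightarrow> e \<otimes> f \<in> idems S"
  using idem_left_commute[of e f f] idem_left_absorb[of e f]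
  by (simp add: idems_def mult_closed mult_assoc)

text \<open>Moving central idempotents rewrites either side as the product of the two idempotents
  \<open>a \<otimes> sinv S a\<close> and \<open>sinv S a \<otimes> a\<close>, whose order does not
  matter.\<close>

lemma sinv_mult_eq_mult_sinv:
  assumes a: "a \<in> carrier S"
  shows "sinv S a \<otimes> a = a \<otimes> sinv S a"
proof -
  let ?i = "sinv S a"
  note c = a sinv_closed[OF a]
  have "a \<otimes> ?i = (a \<otimes> (?i \<otimes> a)) \<otimes> ?i"
    by (simp add: a mult_sinv_mult)
  also have "\<dots> = (?i \<otimes> a) \<otimes> (a \<otimes> ?i)"
    using c by (simp add: idems_central[OF sinv_mult_idem[OF a], symmetric] mult_assoc mult_closed)
  also have "\<dots> = (a \<otimes> ?i) \<otimes> (?i \<otimes> a)"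
    using a by (simp add: idems_central sinv_mult_idem mult_sinv_idem idems_carrier)
  also have "\<dots> = (?i \<otimes> (a \<otimes> ?i)) \<otimes> a"
    using c by (simp add: idems_central[OF mult_sinv_idem[OF a], symmetric] mult_assoc mult_closed)
  also have "\<dots> = ?i \<otimes> a"
    by (simp add: a sinv_mult_sinv)
  finally show ?thesis ..
qed

text \<open>This is the identity of the maximal subgroup containing \<open>a\<close>.\<close>

abbreviation idem_part :: "'a \<Rightarrow> 'a" (\<open>(_\<degree>)\<close> [1000] 999)
  where "a\<degree> \<equiv> a \<otimes> sinv S a"

lemma idem_part_mult_self: "a \<in> carrier S \<Longrightarrow> a\<degree> \<otimes> a = a"
  by (simp add: mult_assoc sinv_closed mult_sinv_mult)

lemma mult_idem_part_self: "a \<in> carrier S \<Longrightarrow> a \<otimes> a\<degree> = a"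
  using idem_part_mult_self[of a] idems_central[of "a\<degree>" a] by (simp add: mult_sinv_idem)

lemma idem_part_idem: "e \<in> idems S \<Longrightarrow> e\<degree> = e"
  by (simp add: sinv_idem idems_idem)

lemma sinv_mult:
  assumes "a \<in> carrier S" "b \<in> carrier S"
  shows "sinv S (a \<otimes> b) = sinv S b \<otimes> sinv S a"
proof (rule sinv_eqI)
  let ?i = "sinv S a" and ?j = "sinv S b"
  note c = assms sinv_closed[OF assms(1)] sinv_closed[OF assms(2)]
  have "(a \<otimes> b) \<otimes> (?j \<otimes> ?i) \<otimes> (a \<otimes> b) = a \<otimes> (b\<degree> \<otimes> ((?i \<otimes> a) \<otimes> b))"
    using c by (simp add: mult_assoc mult_closed)
  also have "\<dots> = (a \<otimes> (?i \<otimes> a)) \<otimes> (b\<degree> \<otimes> b)"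
    using c idem_left_commute[OF mult_sinv_idem[OF assms(2)], of "?i \<otimes> a" b]
    by (simp add: mult_assoc mult_closed)
  finally have 1: "(a \<otimes> b) \<otimes> (?j \<otimes> ?i) \<otimes> (a \<otimes> b) = a \<otimes> b"
    by (simp add: assms mult_sinv_mult idem_part_mult_self)
  have "(?j \<otimes> ?i) \<otimes> (a \<otimes> b) \<otimes> (?j \<otimes> ?i) = ?j \<otimes> ((?i \<otimes> a) \<otimes> (b\<degree> \<otimes> ?i))"
    using c by (simp add: mult_assoc mult_closed)
  also have "\<dots> = (?j \<otimes> b\<degree>) \<otimes> (?i \<otimes> (a \<otimes> ?i))"
    using c idem_left_commute[OF mult_sinv_idem[OF assms(2)], of "?i \<otimes> a" ?i]
    by (simp add: mult_assoc mult_closed)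
  finally have 2: "(?j \<otimes> ?i) \<otimes> (a \<otimes> b) \<otimes> (?j \<otimes> ?i) = ?j \<otimes> ?i"
    by (simp add: assms sinv_mult_sinv)
  show "is_sinv S (a \<otimes> b) (?j \<otimes> ?i)"
    unfolding is_sinv_def using 1 2 c by (simp add: mult_closed)
qed (simp add: assms mult_closed)

text \<open>The inner \<open>b\<degree>\<close> is central and can be pulled out of the product. As
  idempotents commute, it follows that \<open>x \<otimes> y\<close> and \<open>y \<otimes> x\<close>
  lie in the same maximal subgroup.\<close>

lemma idem_part_mult:
  assumes "a \<in> carrier S" "b \<in> carrier S"
  shows "(a \<otimes> b)\<degree> = a\<degree> \<otimes> b\<degree>"
proof -
  note c = assms sinv_closed[OF assms(1)] sinv_closed[OF assms(2)]
  have "(a \<otimes> b)\<degree> = a \<otimes> (b\<degree> \<otimes> sinv S a)"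
    using c by (simp add: sinv_mult mult_assoc mult_closed)
  also have "\<dots> = a\<degree> \<otimes> b\<degree>"
    using c idem_left_commute[OF mult_sinv_idem[OF assms(2)], of a "sinv S a"]
      idems_central[OF mult_sinv_idem[OF assms(2)], of "a\<degree>"]
    by (simp add: mult_closed)
  finally show ?thesis .
qed

text \<open>In the order on idempotents, the equation \<open>x \<otimes> y = t\<close> puts
  \<open>t\<close> below \<open>x\<degree>\<close>, and \<open>t \<otimes> x = x\<close> puts
  \<open>x\<degree>\<close> below \<open>t\<close>.\<close>

lemma idem_part_eqI:
  assumes "t \<in> idems S" "x \<in> carrier S" "y \<in> carrier S" "x \<otimes> y = t" "t \<otimes> x = x"
  shows "x\<degree> = t"
proof -
  have "x\<degree> \<otimes> t = t"
    using assms idem_part_mult_self by (metis mult_assoc mult_sinv_idem idems_carrier)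
  moreover have "t \<otimes> x\<degree> = x\<degree>"
    using assms sinv_closed idems_carrier by (metis mult_assoc)
  ultimately show ?thesis
    using assms idems_central mult_sinv_idem idems_carrier by metis
qed

end

section \<open>All values of the maps lie in one maximal subgroup\<close>

locale idem_invariant_solution = clifford_semigroup +
  fixes s :: "'a \<times> 'a \<Rightarrow> 'a \<times> 'a" and \<theta> :: "'a \<Rightarrow> 'a \<Rightarrow> 'a"
  assumes solution: "pentagon_solution S s \<theta>"
    and invariant: "idem_invariant S \<theta>"
begin

lemma theta_closed: "\<lbrakk>a \<in> carrier S; b \<in> carrier S\<rbrakk> \<Longrightarrow> \<theta> a b \<in> carrier S"
  and theta_mult: "\<lbrakk>a \<in> carrier S; b \<in> carrier S; c \<in> carrier S\<rbrakk>
    \<Longrightarrow> \<theta> a b \<otimes> \<theta> (a \<otimes> b) c = \<theta> a (b \<otimes> c)"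
  and theta_theta: "\<lbrakk>a \<in> carrier S; b \<in> carrier S; c \<in> carrier S\<rbrakk>
    \<Longrightarrow> \<theta> (\<theta> a b) (\<theta> (a \<otimes> b) c) = \<theta> b c"
  using solution unfolding pentagon_solution_def by blast+

lemma theta_idem_eq: "\<lbrakk>a \<in> carrier S; e \<in> idems S; f \<in> idems S\<rbrakk> \<Longrightarrow> \<theta> a e = \<theta> a f"
  using invariant unfolding idem_invariant_def by blast

text \<open>Since \<open>a \<otimes> a\<degree> = a\<close>, the first pentagon identity squares
  \<open>\<theta> a (a\<degree>)\<close> to itself; invariance carries this over to every
  \<open>e\<close>.\<close>

lemma theta_idem_idem:
  assumes "a \<in> carrier S" "e \<in> idems S"
  shows "\<theta> a e \<in> idems S"
proof -
  have "\<theta> a (a\<degree>) \<otimes> \<theta> a (a\<degree>) = \<theta> a (a\<degree>)"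
    using theta_mult[of a "a\<degree>" "a\<degree>"] assms(1)
    by (simp add: mult_idem_part_self mult_sinv_idem idems_carrier idems_idem)
  then have "\<theta> a (a\<degree>) \<in> idems S"
    using assms(1) by (simp add: idems_def theta_closed mult_closed sinv_closed)
  then show ?thesis
    using theta_idem_eq[OF assms(1) assms(2) mult_sinv_idem[OF assms(1)]] by simp
qed

text \<open>The first pentagon identity for \<open>b \<otimes> sinv S b\<close> yields a right
  inverse of \<open>\<theta> a b\<close> relative to the idempotent \<open>\<theta> a e\<close>, and
  for \<open>b\<degree> \<otimes> b\<close> it shows that this idempotent fixes
  \<open>\<theta> a b\<close>.\<close>

lemma idem_part_theta_same:
  assumes "a \<in> carrier S" "b \<in> carrier S" "e \<in> idems S"
  shows "(\<theta> a b)\<degree> = \<theta> a e"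
proof (rule idem_part_eqI)
  have b: "b\<degree> \<in> idems S" "b\<degree> \<in> carrier S"
    using assms(2) by (simp_all add: mult_sinv_idem idems_carrier)
  have e: "\<theta> a (b\<degree>) = \<theta> a e"
    using theta_idem_eq[OF assms(1) b(1) assms(3)] .
  show t: "\<theta> a e \<in> idems S"
    using assms by (simp add: theta_idem_idem)
  show "\<theta> a b \<otimes> \<theta> (a \<otimes> b) (sinv S b) = \<theta> a e"
    using theta_mult[OF assms(1,2) sinv_closed[OF assms(2)]] e by simp
  have "\<theta> a b = \<theta> a e \<otimes> \<theta> (a \<otimes> b\<degree>) b"
    using theta_mult[OF assms(1) b(2) assms(2)] e assms(2) by (simp add: idem_part_mult_self)
  then show "\<theta> a e \<otimes> \<theta> a b = \<theta> a b"
    using t assms b by (simp add: idem_left_absorb theta_closed mult_closed)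
qed (simp_all add: assms theta_closed mult_closed sinv_closed)

text \<open>The two sides are the products of the same two elements in opposite orders. Such
  products have equal idempotent parts, and here both products are idempotent.\<close>

lemma theta_idem_part:
  assumes a: "a \<in> carrier S" and e: "e \<in> idems S"
  shows "\<theta> (a\<degree>) e = \<theta> a e"
proof -
  let ?x = "\<theta> a (sinv S a)" and ?y = "\<theta> (a\<degree>) a"
  have i: "a\<degree> \<in> idems S" "a\<degree> \<in> carrier S" "sinv S a \<in> carrier S"
    using a by (simp_all add: mult_sinv_idem idems_carrier sinv_closed)
  have c: "?x \<in> carrier S" "?y \<in> carrier S"
    using a i by (simp_all add: theta_closed)
  have "?x \<otimes> ?y = \<theta> a e"
    using theta_mult[of a "sinv S a" a] a i theta_idem_eq[OF a i(1) e]
    by (simp add: sinv_mult_eq_mult_sinv)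
  moreover have "?y \<otimes> ?x = \<theta> (a\<degree>) e"
    using theta_mult[of "a\<degree>" a "sinv S a"] a i theta_idem_eq[OF i(2,1) e]
    by (simp add: idem_part_mult_self)
  moreover have "(?x \<otimes> ?y)\<degree> = (?y \<otimes> ?x)\<degree>"
    unfolding idem_part_mult[OF c] idem_part_mult[OF c(2,1)]
    by (rule idems_central) (simp_all add: c mult_sinv_idem idems_carrier)
  ultimately show ?thesis
    using a e i by (simp add: idem_part_idem theta_idem_idem)
qed

lemma theta_idem_const:
  assumes "a \<in> carrier S" "b \<in> carrier S" "e \<in> idems S" "f \<in> idems S"
  shows "\<theta> a e = \<theta> b f"
proof -
  \<comment> \<open>Idempotent parts are taken in the second pentagon identity. The right side does
    not involve \<open>g\<close>, so the choices \<open>a\<degree>\<close> and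
    \<open>b\<degree>\<close> for \<open>g\<close> link \<open>\<theta> a e\<close> to
    \<open>\<theta> b e\<close>.\<close>
  have *: "\<theta> g e = \<theta> (\<theta> a e) e" if g: "g \<in> idems S" for g
  proof -
    have c: "g \<in> carrier S" "e \<in> carrier S" "\<theta> a e \<in> carrier S"
      using g assms by (simp_all add: idems_carrier theta_closed)
    have "\<theta> a g = \<theta> a e"
      using theta_idem_eq[OF assms(1) g assms(3)] .
    then have "(\<theta> (\<theta> a e) (\<theta> (a \<otimes> g) e))\<degree> = (\<theta> g e)\<degree>"
      using theta_theta[OF assms(1) c(1,2)] by simp
    then show ?thesis
      using c assms by (simp add: idem_part_theta_same theta_closed mult_closed)
  qed
  have "\<theta> a e = \<theta> b e"
    using *[of "a\<degree>"] *[of "b\<degree>"] assms by (simp add: mult_sinv_idem theta_idem_part)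
  also have "\<dots> = \<theta> b f"
    using theta_idem_eq[OF assms(2-4)] .
  finally show ?thesis .
qed

lemma idem_part_theta:
  assumes "a \<in> carrier S" "b \<in> carrier S" "c \<in> carrier S" "e \<in> idems S"
  shows "(\<theta> a b)\<degree> = \<theta> c e"
  using idem_part_theta_same[OF assms(1,2,4)] theta_idem_const[OF assms(1,3,4,4)] by simp

text \<open>This is the cancellation rule: the common identity of the subgroup acts trivially on
  every value.\<close>

lemma idem_part_theta_mult_theta:
  assumes "a \<in> carrier S" "b \<in> carrier S" "c \<in> carrier S" "d \<in> carrier S"
  shows "(\<theta> a b)\<degree> \<otimes> \<theta> c d = \<theta> c d"
proof -
  have "(\<theta> a b)\<degree> = (\<theta> c d)\<degree>"
    using idem_part_theta[OF assms(1,2,1) mult_sinv_idem[OF assms(1)]]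
      idem_part_theta[OF assms(3,4,1) mult_sinv_idem[OF assms(1)]] by simp
  then show ?thesis
    using assms by (simp add: idem_part_mult_self theta_closed)
qed

section \<open>The common map \<phi> and its multiplicative behaviour\<close>

text \<open>The second pentagon identity is used for the pairs \<open>(f, e)\<close> and
  \<open>(e, f)\<close>. Its left sides agree because idempotents commute and
  \<open>\<theta> f e = \<theta> e f\<close>.\<close>

lemma theta_idem_left_eq:
  assumes "e \<in> idems S" "f \<in> idems S" "c \<in> carrier S"
  shows "\<theta> e c = \<theta> f c"
proof -
  have c: "e \<in> carrier S" "f \<in> carrier S"
    using assms by (simp_all add: idems_carrier)
  have "\<theta> e c = \<theta> (\<theta> f e) (\<theta> (f \<otimes> e) c)"
    using theta_theta[OF c(2,1) assms(3)] ..
  also have "\<dots> = \<theta> (\<theta> e f) (\<theta> (e \<otimes> f) c)"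
    using assms c idems_central[of e f] theta_idem_const[of f e e f] by simp
  also have "\<dots> = \<theta> f c"
    using theta_theta[OF c assms(3)] .
  finally show ?thesis .
qed

text \<open>The first pentagon identity at \<open>a\<degree>\<close> reads \<phi>(ab) = \<phi>(a)
  \<open>\<theta> a b\<close>, and \<phi>(a) cancels in the subgroup.\<close>

lemma theta_eq:
  assumes "a \<in> carrier S" "b \<in> carrier S" "e \<in> idems S"
  shows "\<theta> a b = sinv S (\<theta> e a) \<otimes> \<theta> e (a \<otimes> b)"
proof -
  have i: "a\<degree> \<in> idems S" "a\<degree> \<in> carrier S" "e \<in> carrier S"
    using assms by (simp_all add: mult_sinv_idem idems_carrier)
  have "\<theta> e (a \<otimes> b) = \<theta> e a \<otimes> \<theta> a b"
    using theta_mult[OF i(2) assms(1,2)] assms i theta_idem_left_eq[OF i(1) assms(3)]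
    by (simp add: idem_part_mult_self mult_closed)
  then have "sinv S (\<theta> e a) \<otimes> \<theta> e (a \<otimes> b) = (sinv S (\<theta> e a) \<otimes> \<theta> e a) \<otimes> \<theta> a b"
    using assms i by (simp add: mult_assoc sinv_closed theta_closed)
  also have "\<dots> = \<theta> a b"
    using assms i by (simp add: sinv_mult_eq_mult_sinv theta_closed idem_part_theta_mult_theta)
  finally show ?thesis ..
qed

text \<open>Splitting the left side by the first pentagon identity gives the factor
  \<open>\<theta> e f\<close>, the identity of the subgroup, and a factor indexed by the idempotent
  \<open>e \<otimes> f\<close>.\<close>

lemma theta_idem_mult:
  assumes "e \<in> idems S" "f \<in> idems S" "c \<in> carrier S"
  shows "\<theta> e (f \<otimes> c) = \<theta> e c"
proof -
  have i: "e \<in> carrier S" "f \<in> carrier S" "e \<otimes> f \<in> idems S" "e \<otimes> f \<in> carrier S"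
    using assms by (simp_all add: idems_carrier idems_mult)
  have "\<theta> e (f \<otimes> c) = \<theta> e f \<otimes> \<theta> (e \<otimes> f) c"
    using theta_mult[OF i(1,2) assms(3)] ..
  also have "\<dots> = (\<theta> (e \<otimes> f) c)\<degree> \<otimes> \<theta> (e \<otimes> f) c"
    using idem_part_theta[OF i(4) assms(3) i(1) assms(2)] by simp
  also have "\<dots> = \<theta> e c"
    using assms i theta_idem_left_eq[of "e \<otimes> f" e c] by (simp add: idem_part_mult_self theta_closed)
  finally show ?thesis .
qed

text \<open>With \<open>a\<degree>\<close> as middle argument, the outer index in the second
  pentagon identity is idempotent, so the outer map is \<phi>. For idempotent \<open>a\<close> this
  says that \<phi> is an idempotent map.\<close>

lemma theta_idem_theta:
  assumes "e \<in> idems S" "a \<in> carrier S" "c \<in> carrier S"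
  shows "\<theta> e (\<theta> a c) = \<theta> e c"
proof -
  have i: "a\<degree> \<in> idems S" "a\<degree> \<in> carrier S"
    using assms by (simp_all add: mult_sinv_idem idems_carrier)
  have "\<theta> (\<theta> a (a\<degree>)) (\<theta> a c) = \<theta> (a\<degree>) c"
    using theta_theta[OF assms(2) i(2) assms(3)] assms by (simp add: mult_idem_part_self)
  then show ?thesis
    using theta_idem_left_eq theta_idem_idem theta_closed assms i by metis
qed

text \<open>Apply \<phi> to the formula for \<open>\<theta> a (sinv S a \<otimes> c)\<close>. The
  right side depends on \<open>a\<close> and \<open>c\<close> only through their images under
  \<phi>, which is the source of the congruence.\<close>

lemma theta_sinv_mult:
  assumes "e \<in> idems S" "a \<in> carrier S" "c \<in> carrier S"
  shows "\<theta> e (sinv S a \<otimes> c) = \<theta> e (sinv S (\<theta> e a) \<otimes> \<theta> e c)"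
proof -
  have i: "a\<degree> \<in> idems S" "sinv S a \<in> carrier S" "sinv S a \<otimes> c \<in> carrier S"
    using assms by (simp_all add: mult_sinv_idem sinv_closed mult_closed)
  have "\<theta> a (sinv S a \<otimes> c) = sinv S (\<theta> e a) \<otimes> \<theta> e (a\<degree> \<otimes> c)"
    using theta_eq[OF assms(2) i(3) assms(1)] assms i by (simp add: mult_assoc)
  then have "\<theta> a (sinv S a \<otimes> c) = sinv S (\<theta> e a) \<otimes> \<theta> e c"
    using assms i by (simp add: theta_idem_mult)
  then show ?thesis
    using theta_idem_theta[OF assms(1,2) i(3)] by simp
qed

lemma theta_sinv_cong:
  assumes "e \<in> idems S" "a \<in> carrier S" "b \<in> carrier S" "\<theta> e a = \<theta> e b"
  shows "\<theta> e (sinv S a) = \<theta> e (sinv S b)"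
proof -
  \<comment> \<open>Here \<open>sinv S x\<close> is written as
    \<open>sinv S x \<otimes> x\<degree>\<close>, and \<phi> takes the same value at
    \<open>x\<degree>\<close> as at \<open>e\<close>.\<close>
  have "\<theta> e (sinv S x) = \<theta> e (sinv S (\<theta> e x) \<otimes> \<theta> e e)" if x: "x \<in> carrier S" for x
  proof -
    have "\<theta> e (sinv S x) = \<theta> e (sinv S (\<theta> e x) \<otimes> \<theta> e (x\<degree>))"
      using theta_sinv_mult[of e x "x\<degree>"] assms(1) x
      by (simp add: sinv_mult_sinv mult_closed sinv_closed)
    then show ?thesis
      using theta_idem_eq[of e "x\<degree>" e] assms(1) x by (simp add: mult_sinv_idem idems_carrier)
  qed
  then show ?thesis
    using assms by simp
qed

text \<open>A product is a left quotient by an inverse, so compatibility with left quotients and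
  with inverses suffices.\<close>

lemma theta_mult_cong:
  assumes "e \<in> idems S" "a \<in> carrier S" "b \<in> carrier S" "c \<in> carrier S" "d \<in> carrier S"
    and "\<theta> e a = \<theta> e b" "\<theta> e c = \<theta> e d"
  shows "\<theta> e (a \<otimes> c) = \<theta> e (b \<otimes> d)"
proof -
  have sinv_sinv: "sinv S (sinv S x) = x" if "x \<in> carrier S" for x
    using that sinv_closed is_sinv_sinv by (intro sinv_eqI) (auto simp: is_sinv_def)
  show ?thesis
    using theta_sinv_mult[of e "sinv S a" c] theta_sinv_mult[of e "sinv S b" d]
      theta_sinv_cong[of e a b] assms
    by (simp add: sinv_sinv sinv_closed)
qed

section \<open>The kernel and its congruence pair\<close>

text \<open>The value \<phi>(a) lies in a group with identity \<open>\<theta> e e\<close>, where the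
  only idempotent is that identity.\<close>

lemma mem_kernel_iff:
  assumes "e \<in> idems S"
  shows "a \<in> solution_kernel S \<theta> \<longleftrightarrow> a \<in> carrier S \<and> \<theta> e a = \<theta> e e"
proof -
  have e: "e \<in> carrier S"
    using assms by (rule idems_carrier)
  have idem_iff: "\<theta> f a \<in> idems S \<longleftrightarrow> \<theta> e a = \<theta> e e"
    if a: "a \<in> carrier S" and f: "f \<in> idems S" for f
  proof -
    have eq: "\<theta> f a = \<theta> e a"
      using theta_idem_left_eq[OF f assms a] .
    show ?thesis
      unfolding eq using idem_part_theta[OF e a e assms] theta_idem_idem[OF e assms]
      by (metis idem_part_idem)
  qed
  \<comment> \<open>This provides an idempotent below \<open>a\<close>, so the condition defining
    the kernel is never vacuous.\<close>
  have below: "sle S (a\<degree>) a" if "a \<in> carrier S"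
    using that by (simp add: sle_def idem_part_idem idems_idem mult_sinv_idem)
  show ?thesis
    unfolding solution_kernel_def using idem_iff below mult_sinv_idem by blast
qed

text \<open>As \<tau> is the full relation, only the kernel condition remains. Multiplying by
  \<open>b\<close> turns it into equality of images, because \<phi> absorbs the idempotent
  \<open>sinv S b \<otimes> b\<close>.\<close>

lemma kernel_pair_rel:
  assumes e: "e \<in> idems S"
  shows "pair_rel S (solution_kernel S \<theta>) (idems S \<times> idems S) =
    {(a, b). a \<in> carrier S \<and> b \<in> carrier S \<and> \<theta> e a = \<theta> e b}"
proof -
  have "a \<otimes> sinv S b \<in> solution_kernel S \<theta> \<longleftrightarrow> \<theta> e a = \<theta> e b"
    if ab: "a \<in> carrier S" "b \<in> carrier S" for a b
  proof
    note i = e idems_carrier[OF e] ab sinv_closed[OF ab(2)] mult_closed[OF ab(1) sinv_closed[OF ab(2)]]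
    have bb: "sinv S b \<otimes> b \<in> idems S" "b\<degree> \<in> idems S"
      using ab by (simp_all add: sinv_mult_idem mult_sinv_idem)
    { assume "a \<otimes> sinv S b \<in> solution_kernel S \<theta>"
      then have "\<theta> e (a \<otimes> sinv S b) = \<theta> e e"
        using mem_kernel_iff[OF e] by blast
      then have "\<theta> e (a \<otimes> sinv S b \<otimes> b) = \<theta> e (e \<otimes> b)"
        using i by (intro theta_mult_cong) simp_all
      moreover have "a \<otimes> sinv S b \<otimes> b = (sinv S b \<otimes> b) \<otimes> a"
        using i bb by (simp add: mult_assoc idems_central)
      ultimately show "\<theta> e a = \<theta> e b"
        using i bb by (simp add: theta_idem_mult)
    next
      assume "\<theta> e a = \<theta> e b"
      then have "\<theta> e (a \<otimes> sinv S b) = \<theta> e (b\<degree>)"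
        using i by (intro theta_mult_cong) simp_all
      then show "a \<otimes> sinv S b \<in> solution_kernel S \<theta>"
        using i bb theta_idem_eq[of e "b\<degree>" e] mem_kernel_iff[OF e] by simp
    }
  qed
  then show ?thesis
    unfolding pair_rel_def by (auto simp: sinv_mult_idem)
qed

lemma kernel_congruence_pair:
  "congruence_pair S (solution_kernel S \<theta>) (idems S \<times> idems S)"
proof -
  obtain x where x: "x \<in> carrier S"
    using carrier_nonempty by blast
  define e where "e = x\<degree>"
  have e: "e \<in> idems S" "e \<in> carrier S"
    using x by (simp_all add: e_def mult_sinv_idem idems_carrier)
  note K = mem_kernel_iff[OF e(1)]
  have idem_conj: "sinv S a \<otimes> f \<otimes> a \<in> idems S" if "a \<in> carrier S" "f \<in> idems S" for a f
  proof -
    have "sinv S a \<otimes> f \<otimes> a = f \<otimes> (sinv S a \<otimes> a)"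
      using that idem_left_commute[of f "sinv S a" a]
      by (simp add: mult_assoc idems_carrier sinv_closed)
    then show ?thesis
      using that by (simp add: idems_mult sinv_mult_idem)
  qed
  have mult: "a \<otimes> b \<in> solution_kernel S \<theta>"
    if "a \<in> solution_kernel S \<theta>" "b \<in> solution_kernel S \<theta>" for a b
    using that theta_mult_cong[of e a e b e] e by (simp add: K mult_closed idems_idem)
  have idem: "f \<in> solution_kernel S \<theta>" if "f \<in> idems S" for f
    using that e theta_idem_eq[of e f e] by (simp add: K idems_carrier)
  have conj: "sinv S a \<otimes> k \<otimes> a \<in> solution_kernel S \<theta>"
    if a: "a \<in> carrier S" and k: "k \<in> solution_kernel S \<theta>" for a k
  proof -
    have i: "sinv S a \<in> carrier S" "k \<in> carrier S" "\<theta> e k = \<theta> e e"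
      using a k by (simp_all add: sinv_closed K)
    \<comment> \<open>Under \<phi> the kernel element \<open>k\<close> may be replaced by
      \<open>e\<close>, after which the conjugate is idempotent.\<close>
    have "\<theta> e (sinv S a \<otimes> k) = \<theta> e (sinv S a \<otimes> e)"
      using a i e by (intro theta_mult_cong) simp_all
    then have "\<theta> e (sinv S a \<otimes> k \<otimes> a) = \<theta> e (sinv S a \<otimes> e \<otimes> a)"
      using a i e by (intro theta_mult_cong) (simp_all add: mult_closed)
    also have "\<dots> = \<theta> e e"
      using theta_idem_eq[OF e(2) idem_conj[OF a e(1)] e(1)] .
    finally show ?thesis
      using a i by (simp add: K mult_closed)
  qed
  \<comment> \<open>The factor \<open>f\<close> disappears because \<phi> absorbs
    idempotents.\<close>
  have cancel: "a \<in> solution_kernel S \<theta>"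
    if "a \<in> carrier S" "f \<in> idems S" "a \<otimes> f \<in> solution_kernel S \<theta>" for a f
    using that theta_idem_mult[of e f a] idems_central[of f a] e by (simp add: K)
  have equiv: "equiv (idems S) (idems S \<times> idems S)"
    by (auto simp: equiv_def refl_on_def sym_on_def trans_on_def)
  have "normal_subsemigroup S (solution_kernel S \<theta>)"
    unfolding normal_subsemigroup_def using mult idem conj K by blast
  moreover have "normal_congruence S (idems S \<times> idems S)"
    unfolding normal_congruence_def congruence_on_def using equiv idems_mult idem_conj by blast
  ultimately show ?thesis
    unfolding congruence_pair_def using cancel by blast
qed

section \<open>The quotient group and its representatives\<close>

lemma kernel_pair_rel_congruence:
  "congruence_on S (carrier S) (pair_rel S (solution_kernel S \<theta>) (idems S \<times> idems S))"
proof -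
  obtain x where x: "x \<in> carrier S"
    using carrier_nonempty by blast
  have e: "x\<degree> \<in> idems S"
    using x by (rule mult_sinv_idem)
  show ?thesis
    unfolding kernel_pair_rel[OF e] congruence_on_def
    using theta_mult_cong[OF e]
    by (auto simp: equiv_def refl_on_def sym_on_def trans_on_def mult_closed)
qed

lemma kernel_quotient_is_group:
  "quotient_is_group S (pair_rel S (solution_kernel S \<theta>) (idems S \<times> idems S))"
proof -
  let ?\<rho> = "pair_rel S (solution_kernel S \<theta>) (idems S \<times> idems S)"
  obtain x where x: "x \<in> carrier S"
    using carrier_nonempty by blast
  define e where "e = x\<degree>"
  have e: "e \<in> idems S" "e \<in> carrier S"
    using x by (simp_all add: e_def mult_sinv_idem idems_carrier)
  have cong: "congruence_on S (carrier S) ?\<rho>"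
    by (rule kernel_pair_rel_congruence)
  then have eq: "equiv (carrier S) ?\<rho>"
    by (simp add: congruence_on_def)
  have cls: "?\<rho> `` {a} = ?\<rho> `` {b} \<longleftrightarrow> \<theta> e a = \<theta> e b" if "a \<in> carrier S" "b \<in> carrier S" for a b
    using eq_equiv_class_iff[OF eq that] that by (simp add: kernel_pair_rel[OF e(1)])
  \<comment> \<open>The class of \<open>e\<close>, which contains all idempotents, is the witness
    for the identity.\<close>
  let ?Q = "quotient_struct S ?\<rho> (?\<rho> `` {e})"
  have mult: "?\<rho> `` {a} \<otimes>\<^bsub>?Q\<^esub> ?\<rho> `` {b} = ?\<rho> `` {a \<otimes> b}"
    if ab: "a \<in> carrier S" "b \<in> carrier S" for a b
  proof -
    have "?\<rho> `` {c \<otimes> d} = ?\<rho> `` {a \<otimes> b}" if "c \<in> ?\<rho> `` {a}" "d \<in> ?\<rho> `` {b}" for c d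
      using that ab theta_mult_cong[OF e(1), of a c b d]
      by (subst cls) (auto simp: kernel_pair_rel[OF e(1)] mult_closed)
    then have "?\<rho> `` {a} \<otimes>\<^bsub>?Q\<^esub> ?\<rho> `` {b} =
        (\<Union>c\<in>?\<rho> `` {a}. \<Union>d\<in>?\<rho> `` {b}. ?\<rho> `` {a \<otimes> b})"
      unfolding quotient_struct_def monoid.simps by (intro SUP_cong refl)
    \<comment> \<open>The union now has a constant body; nonempty index sets ensure that it equals
      that body rather than the empty set.\<close>
    moreover have "?\<rho> `` {a} \<noteq> {}" "?\<rho> `` {b} \<noteq> {}"
      using equiv_class_self[OF eq ab(1)] equiv_class_self[OF eq ab(2)] by (metis empty_iff)+
    ultimately show ?thesis
      by (simp only: UN_constant if_False)
  qed
  have carr: "carrier ?Q = carrier S // ?\<rho>" and one: "\<one>\<^bsub>?Q\<^esub> = ?\<rho> `` {e}"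
    by (simp_all add: quotient_struct_def)
  have "group ?Q"
  proof (rule groupI)
    fix A B assume "A \<in> carrier ?Q" "B \<in> carrier ?Q"
    then show "A \<otimes>\<^bsub>?Q\<^esub> B \<in> carrier ?Q"
      unfolding carr by (elim quotientE) (simp add: mult mult_closed quotientI)
  next
    show "\<one>\<^bsub>?Q\<^esub> \<in> carrier ?Q"
      using e by (simp add: carr one quotientI)
  next
    fix A B C assume "A \<in> carrier ?Q" "B \<in> carrier ?Q" "C \<in> carrier ?Q"
    then show "A \<otimes>\<^bsub>?Q\<^esub> B \<otimes>\<^bsub>?Q\<^esub> C = A \<otimes>\<^bsub>?Q\<^esub> (B \<otimes>\<^bsub>?Q\<^esub> C)"
      unfolding carr by (elim quotientE) (simp add: mult mult_closed mult_assoc)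
  next
    fix A assume "A \<in> carrier ?Q"
    then obtain a where a: "a \<in> carrier S" "A = ?\<rho> `` {a}"
      unfolding carr by (elim quotientE)
    show "\<one>\<^bsub>?Q\<^esub> \<otimes>\<^bsub>?Q\<^esub> A = A"
      using a e by (simp add: one mult cls mult_closed theta_idem_mult)
    have "?\<rho> `` {sinv S a} \<otimes>\<^bsub>?Q\<^esub> A = \<one>\<^bsub>?Q\<^esub>"
      using a e theta_idem_eq[of e "sinv S a \<otimes> a" e]
      by (simp add: one mult cls mult_closed sinv_closed sinv_mult_idem)
    then show "\<exists>B\<in>carrier ?Q. B \<otimes>\<^bsub>?Q\<^esub> A = \<one>\<^bsub>?Q\<^esub>"
      using a by (intro bexI[of _ "?\<rho> `` {sinv S a}"]) (simp_all add: carr quotientI sinv_closed)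
  qed
  then show ?thesis
    unfolding quotient_is_group_def using cong by blast
qed

lemma kernel_pair_rel_theta:
  assumes "e \<in> idems S" "a \<in> carrier S"
  shows "(\<theta> e a, a) \<in> pair_rel S (solution_kernel S \<theta>) (idems S \<times> idems S)"
  using assms by (simp add: kernel_pair_rel[OF assms(1)] idems_carrier theta_closed theta_idem_theta)

text \<open>Since \<phi> is idempotent, \<phi>(a) lies in the class of \<open>a\<close>, and any
  value of \<phi> in this class is fixed by \<phi> and hence equals \<phi>(a).\<close>

lemma theta_image_representatives:
  assumes e: "e \<in> idems S"
  shows "representatives (carrier S)
    (pair_rel S (solution_kernel S \<theta>) (idems S \<times> idems S)) (\<theta> e ` carrier S)"
  unfolding representatives_def
proof (intro conjI ballI)
  have ec: "e \<in> carrier S"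
    using e by (rule idems_carrier)
  then show "\<theta> e ` carrier S \<subseteq> carrier S"
    by (auto simp: theta_closed)
  let ?\<rho> = "pair_rel S (solution_kernel S \<theta>) (idems S \<times> idems S)"
  fix C assume "C \<in> carrier S // ?\<rho>"
  then obtain a where a: "a \<in> carrier S" "C = ?\<rho> `` {a}"
    by (elim quotientE)
  show "\<exists>!x. x \<in> \<theta> e ` carrier S \<inter> C"
  proof
    show "\<theta> e a \<in> \<theta> e ` carrier S \<inter> C"
      using a ec e by (simp add: kernel_pair_rel[OF e] theta_closed theta_idem_theta)
  next
    fix y assume "y \<in> \<theta> e ` carrier S \<inter> C"
    then show "y = \<theta> e a"
      using a ec e by (auto simp: kernel_pair_rel[OF e] theta_idem_theta)
  qed
qed

end

theorem theorem15:
  fixes S :: "('a, 'm) monoid_scheme" (structure)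
    and s :: "'a \<times> 'a \<Rightarrow> 'a \<times> 'a"
    and \<theta> :: "'a \<Rightarrow> 'a \<Rightarrow> 'a"
  assumes "clifford_semigroup S"
    and "pentagon_solution S s \<theta>"
    and "idem_invariant S \<theta>"
  defines "K \<equiv> solution_kernel S \<theta>"
    and "\<tau> \<equiv> idems S \<times> idems S"
  shows
    "(\<forall>e\<in>idems S. \<forall>a\<in>carrier S. \<forall>b\<in>carrier S.
        \<theta> e (a \<otimes> b) = \<theta> e a \<otimes> sinv S (\<theta> e a) \<otimes> \<theta> e (a \<otimes> b)) \<and>
     (\<forall>a\<in>carrier S. \<forall>b\<in>carrier S. \<forall>e\<in>idems S.
        \<theta> a b = sinv S (\<theta> e a) \<otimes> \<theta> e (a \<otimes> b)) \<and>
     congruence_pair S K \<tau> \<and>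
     quotient_is_group S (pair_rel S K \<tau>) \<and>
     (\<forall>e\<in>idems S.
        representatives (carrier S) (pair_rel S K \<tau>) (\<theta> e ` carrier S) \<and>
        (\<forall>a\<in>carrier S. (\<theta> e a, a) \<in> pair_rel S K \<tau>))"
proof -
  interpret idem_invariant_solution S s \<theta>
    using assms(1-3)
    by (intro idem_invariant_solution.intro idem_invariant_solution_axioms.intro)
  have "\<theta> e (a \<otimes> b) = \<theta> e a \<otimes> sinv S (\<theta> e a) \<otimes> \<theta> e (a \<otimes> b)"
    if "e \<in> idems S" "a \<in> carrier S" "b \<in> carrier S" for e a b
    using that by (simp add: idem_part_theta_mult_theta idems_carrier mult_closed)
  then show ?thesis
    unfolding K_def \<tau>_def
    using theta_eq kernel_congruence_pair kernel_quotient_is_group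
      theta_image_representatives kernel_pair_rel_theta
    by blast
qed

end
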